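(* Let $G$ be an Abelian Polish group and let $\mu$ be a Borel probability measure on $G$. Then the possible exact coupling set and the successful exact coupling set of $\mu$ coincide: $G_p = G_s$.
   Context: A Polish group is a topological group whose topology is separable and completely metrizable. For $x \in G$, $\mathrm{RW}(x,\mu)$ is the law on $G^{\mathbb{N}}$ of the random walk $S^x = \{S^x_n\}_{n=0}^\infty$ with $S^x_n = x + X_1 + \cdots + X_n$, where the $X_i$ are i.i.d. with distribution $\mu$. An exact coupling of $\mathrm{RW}(0,\mu)$ and $\mathrm{RW}(x,\mu)$ is a triple $(S,S^x,T)$ defined on one probability space $(\Omega,\mathcal{F},\mathbf{P})$ with $S \sim \mathrm{RW}(0,\mu)$, $S^x \sim \mathrm{RW}(x,\mu)$ and $T$ a random time (with values in $\{0,1,2,\dots\}\cup\{\infty\}$) such that $S_n = S^x_n$ for all $n \geq T$. It is successful if $T < \infty$ almost surely, and possible if $\mathbf{P}(T < \infty) > 0$. $G_s$ (respectively $G_p$) is the set of all $x \in G$ such that there exists a successful (respectively possible) exact coupling of $\mathrm{RW}(0,\mu)$ and $\mathrm{RW}(x,\mu)$. *)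

theory Defs
  imports "HOL-Probability.Probability" "HOL-Library.Extended_Nat"
begin

abbreviation path_space :: "(nat \<Rightarrow> 'a::topological_space) measure" where
  "path_space \<equiv> PiM UNIV (\<lambda>_. borel)"

text \<open>The coordinate \<open>X i\<close> is the \<open>(i + 1)\<close>-st increment of the walk.\<close>

definition RW :: "'a::{polish_space, topological_ab_group_add} \<Rightarrow> 'a measure \<Rightarrow> (nat \<Rightarrow> 'a) measure" where
  "RW x \<mu> = distr (PiM UNIV (\<lambda>_::nat. \<mu>)) path_space (\<lambda>X n. x + (\<Sum>i<n. X i))"

text \<open>The time \<open>T\<close> is only required to be measurable; it need not be a stopping time.\<close>

definition exact_coupling ::
  "'a::{polish_space, topological_ab_group_add} measure \<Rightarrow> 'a \<Rightarrow> 'w measure \<Rightarrow>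
    ('w \<Rightarrow> nat \<Rightarrow> 'a) \<Rightarrow> ('w \<Rightarrow> nat \<Rightarrow> 'a) \<Rightarrow> ('w \<Rightarrow> enat) \<Rightarrow> bool" where
  "exact_coupling \<mu> x M S S' T \<longleftrightarrow>
     prob_space M \<and>
     S \<in> measurable M path_space \<and> distr M path_space S = RW 0 \<mu> \<and>
     S' \<in> measurable M path_space \<and> distr M path_space S' = RW x \<mu> \<and>
     T \<in> measurable M (count_space UNIV) \<and>
     (\<forall>\<omega>\<in>space M. \<forall>n. T \<omega> \<le> enat n \<longrightarrow> S \<omega> n = S' \<omega> n)"

text \<open>
  A formula cannot quantify over the type of sample points, so the probability space below
  ranges over all measures on one sufficiently large type, that of triples (path, path, time).
  The lemmas at the end show that this is no restriction: a coupling on a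
  probability space over any type of sample points also gives membership in these sets.
\<close>

type_synonym 'a sample = "(nat \<Rightarrow> 'a) \<times> (nat \<Rightarrow> 'a) \<times> enat"

definition successful_coupling_set ::
  "'a::{polish_space, topological_ab_group_add} measure \<Rightarrow> 'a set" where
  "successful_coupling_set \<mu> =
     {x. \<exists>(M :: 'a sample measure) S S' T.
           exact_coupling \<mu> x M S S' T \<and> (AE \<omega> in M. T \<omega> < \<infinity>)}"

definition possible_coupling_set ::
  "'a::{polish_space, topological_ab_group_add} measure \<Rightarrow> 'a set" where
  "possible_coupling_set \<mu> =
     {x. \<exists>(M :: 'a sample measure) S S' T.
           exact_coupling \<mu> x M S S' T \<and> \<P>(\<omega> in M. T \<omega> < \<infinity>) > 0}"

lemma exact_coupling_canonical:
  fixes M :: "'w measure" and \<mu> :: "'a::{polish_space, topological_ab_group_add} measure"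
  assumes "exact_coupling \<mu> x M S S' T"
  obtains N :: "'a sample measure" and R R' U where
    "exact_coupling \<mu> x N R R' U"
    "distr N (count_space UNIV) U = distr M (count_space UNIV) T"
proof -
  note [measurable] = assms[unfolded exact_coupling_def, THEN conjunct2, THEN conjunct1]
    assms[unfolded exact_coupling_def, THEN conjunct2, THEN conjunct2, THEN conjunct2, THEN conjunct1]
  have [measurable]: "T \<in> measurable M (count_space UNIV)"
    and pM: "prob_space M"
    and dS: "distr M path_space S = RW 0 \<mu>" "distr M path_space S' = RW x \<mu>"
    and eq: "\<And>\<omega> n. \<omega> \<in> space M \<Longrightarrow> T \<omega> \<le> enat n \<Longrightarrow> S \<omega> n = S' \<omega> n"
    using assms by (auto simp: exact_coupling_def)
  define P :: "'a sample measure" where "P = path_space \<Otimes>\<^sub>M path_space \<Otimes>\<^sub>M count_space UNIV"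
  define f where "f = (\<lambda>\<omega>. (S \<omega>, S' \<omega>, T \<omega>))"
  define V :: "'a sample \<Rightarrow> enat" where "V = (\<lambda>z. snd (snd z))"
  define U :: "'a sample \<Rightarrow> enat" where
    "U = (\<lambda>z. if \<forall>n. V z \<le> enat n \<longrightarrow> fst z n = fst (snd z) n then V z else \<infinity>)"
  define N where "N = distr M P f"
  have f [measurable]: "f \<in> measurable M P" unfolding f_def P_def by measurable
  have m1 [measurable]: "fst \<in> measurable P path_space" unfolding P_def by measurable
  have m2 [measurable]: "(\<lambda>z. fst (snd z)) \<in> measurable P path_space" unfolding P_def by measurable
  have V [measurable]: "V \<in> measurable P (count_space UNIV)" unfolding P_def V_def by measurable
  have c1: "(\<lambda>z. fst z n) \<in> borel_measurable P" for n
    using measurable_compose[OF m1 measurable_component_singleton[of n UNIV "\<lambda>_. borel"]] by simp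
  have c2: "(\<lambda>z. fst (snd z) n) \<in> borel_measurable P" for n
    using measurable_compose[OF m2 measurable_component_singleton[of n UNIV "\<lambda>_. borel"]] by simp
  have [measurable]: "Measurable.pred P (\<lambda>z. fst z n = fst (snd z) n)" for n
    using measurable_equality_set[OF c1 c2] by (simp add: pred_def)
  have U [measurable]: "U \<in> measurable P (count_space UNIV)" unfolding U_def by measurable
  have Uf: "U (f \<omega>) = T \<omega>" if "\<omega> \<in> space M" for \<omega>
    using eq[OF that] by (auto simp: U_def V_def f_def)
  have "exact_coupling \<mu> x N fst (\<lambda>z. fst (snd z)) U"
    unfolding exact_coupling_def
  proof (intro conjI)
    show "prob_space N" unfolding N_def using pM f by (rule prob_space.prob_space_distr)
    show "distr N path_space fst = RW 0 \<mu>"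
      unfolding N_def dS(1)[symmetric] using distr_distr[OF m1 f] by (simp add: f_def comp_def)
    show "distr N path_space (\<lambda>z. fst (snd z)) = RW x \<mu>"
      unfolding N_def dS(2)[symmetric] using distr_distr[OF m2 f] by (simp add: f_def comp_def)
    show "\<forall>\<omega>\<in>space N. \<forall>n. U \<omega> \<le> enat n \<longrightarrow> fst \<omega> n = fst (snd \<omega>) n"
      by (auto simp: U_def)
  qed (simp_all add: N_def)
  moreover have "distr N (count_space UNIV) U = distr M (count_space UNIV) T"
    unfolding N_def by (subst distr_distr[OF U f]) (auto intro!: distr_cong simp: Uf)
  ultimately show ?thesis by (rule that)
qed

lemma successful_coupling_setI:
  fixes M :: "'w measure" and \<mu> :: "'a::{polish_space, topological_ab_group_add} measure"
  assumes "exact_coupling \<mu> x M S S' T" "AE \<omega> in M. T \<omega> < \<infinity>"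
  shows "x \<in> successful_coupling_set \<mu>"
proof -
  obtain N :: "'a sample measure" and R R' U where N: "exact_coupling \<mu> x N R R' U"
    and d: "distr N (count_space UNIV) U = distr M (count_space UNIV) T"
    using exact_coupling_canonical[OF assms(1)] .
  have [measurable]: "T \<in> measurable M (count_space UNIV)" "U \<in> measurable N (count_space UNIV)"
    using assms(1) N by (auto simp: exact_coupling_def)
  have "AE t in distr N (count_space UNIV) U. t < \<infinity>"
    unfolding d using assms(2) by (subst AE_distr_iff) auto
  then have "AE \<omega> in N. U \<omega> < \<infinity>" by (subst (asm) AE_distr_iff) auto
  with N show ?thesis unfolding successful_coupling_set_def by blast
qed

lemma possible_coupling_setI:
  fixes M :: "'w measure" and \<mu> :: "'a::{polish_space, topological_ab_group_add} measure"
  assumes "exact_coupling \<mu> x M S S' T" "\<P>(\<omega> in M. T \<omega> < \<infinity>) > 0"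
  shows "x \<in> possible_coupling_set \<mu>"
proof -
  obtain N :: "'a sample measure" and R R' U where N: "exact_coupling \<mu> x N R R' U"
    and d: "distr N (count_space UNIV) U = distr M (count_space UNIV) T"
    using exact_coupling_canonical[OF assms(1)] .
  have T: "T \<in> measurable M (count_space UNIV)" "U \<in> measurable N (count_space UNIV)"
    using assms(1) N by (auto simp: exact_coupling_def)
  have "\<P>(\<omega> in N. U \<omega> < \<infinity>) = measure (distr N (count_space UNIV) U) {t. t < \<infinity>}"
    by (subst measure_distr[OF T(2)]) (auto intro!: arg_cong[where f="measure N"])
  also have "\<dots> = \<P>(\<omega> in M. T \<omega> < \<infinity>)"
    unfolding d by (subst measure_distr[OF T(1)]) (auto intro!: arg_cong[where f="measure M"])
  finally have "\<P>(\<omega> in N. U \<omega> < \<infinity>) > 0" using assms(2) by simp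
  with N show ?thesis unfolding possible_coupling_set_def by blast
qed

end

theory Submission imports Defs begin

text \<open>
  A successful coupling meets almost surely, hence with probability \<open>1 > 0\<close>, so only one
  inclusion has content. Given a possible coupling, some \<open>n\<close> satisfies \<open>S n = S' n\<close> with positive
  probability. In terms of the increments \<open>X\<close> and \<open>X'\<close> of the two walks this is an event \<open>A\<close> of
  positive probability on which the first \<open>n\<close> increments satisfy \<open>\<Sum> X = x + \<Sum> X'\<close>, while \<open>X\<close> and
  \<open>X'\<close> are both i.i.d. with law \<open>\<mu>\<close>.

  The new coupling runs in blocks of \<open>n\<close> increments. Each block takes a fresh copy of the pair
  \<open>(X, X')\<close> together with an independent fair coin. The first walk uses \<open>X\<close> or \<open>X'\<close> according to
  the coin; the second walk obeys the same coin, except that on \<open>A\<close>, as long as the walks have not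
  yet met, it obeys the coin turned over. Turning a fair coin over, by a rule that depends only on
  the past and on \<open>(X, X')\<close>, leaves it fair and independent, so the increments of
  both walks are again i.i.d. with law \<open>\<mu>\<close> (\<open>distr_turned_coin\<close>, \<open>distr_run_output\<close>,
  \<open>distr_PiM_concat\<close>). Since the two pieces \<open>X\<close>, \<open>X'\<close> are exchanged as whole sequences, the joint
  law of a block of increments given its sum, and hence any disintegration of measures, is avoided.

  After each block the second walk is ahead of the first by a multiple \<open>K\<close> of \<open>x\<close>, where \<open>K\<close>
  starts at \<open>1\<close>, moves by \<open>1\<close> or \<open>-1\<close> with equal probability on \<open>A\<close>, rests off \<open>A\<close>, and
  stays at \<open>0\<close> once there. This lazy symmetric walk reaches \<open>0\<close> almost surely (\<open>walk_hits_zero\<close>):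
  the probability of never reaching \<open>0\<close> is, as a function of the starting point, harmonic on the
  positive integers and zero at \<open>0\<close>, hence linear, and being bounded it vanishes. From the hitting
  time on both walks use the same increments, so they agree for ever.
\<close>

section \<open>Laws of i.i.d. sequences\<close>

lemma sequence_space_prob: "prob_space \<mu> \<Longrightarrow> sequence_space \<mu>"
  by (simp add: sequence_space_def product_prob_spaceI)

text \<open>
  Restricting to cylinders over the first \<open>L * b\<close> coordinates loses nothing, as every finite set of
  indices lies in such an initial segment. The parameter \<open>b\<close> lets a sequence that is built from
  blocks of length \<open>b\<close> be examined on whole blocks only.
\<close>

lemma PiM_eqI_initial_cylinders:
  fixes \<mu> :: "'b measure" and P :: "(nat \<Rightarrow> 'b) measure"
  assumes \<mu>: "prob_space \<mu>" and sets_eq: "sets P = sets (PiM UNIV (\<lambda>_. \<mu>))" and b: "0 < b"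
    and cylinder: "\<And>B L. (\<And>i. B i \<in> sets \<mu>) \<Longrightarrow>
      emeasure P {z \<in> space P. \<forall>i<L * b. z i \<in> B i} = (\<Prod>i<L * b. emeasure \<mu> (B i))"
  shows "P = PiM UNIV (\<lambda>_. \<mu>)"
proof -
  interpret sequence_space \<mu> using \<mu> by (rule sequence_space_prob)
  show ?thesis
  proof (rule PiM_eq[OF sets_eq])
    fix J :: "nat set" and F assume J: "finite J" and F: "\<And>j. j \<in> J \<Longrightarrow> F j \<in> sets \<mu>"
    obtain m where m: "J \<subseteq> {..<m}" using J finite_nat_bounded by blast
    with b have mb: "J \<subseteq> {..<m * b}" by (fastforce intro: less_le_trans)
    define B where "B i = (if i \<in> J then F i else space \<mu>)" for i
    have space: "space P = UNIV \<rightarrow>\<^sub>E space \<mu>" using sets_eq_imp_space_eq[OF sets_eq] by (simp add: space_PiM)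
    have "prod_emb UNIV (\<lambda>_. \<mu>) J (Pi\<^sub>E J F) = {z \<in> space P. \<forall>i<m * b. z i \<in> B i}"
      using mb by (auto simp: prod_emb_def space B_def PiE_iff subset_iff)
    also have "emeasure P \<dots> = (\<Prod>i<m * b. emeasure \<mu> (B i))"
      using F by (intro cylinder) (auto simp: B_def)
    also have "\<dots> = (\<Prod>j\<in>J. emeasure \<mu> (F j))"
      using mb by (intro prod.mono_neutral_cong_right) (auto simp: B_def prob_space.emeasure_space_1[OF \<mu>])
    finally show "emeasure P (prod_emb UNIV (\<lambda>_. \<mu>) J (Pi\<^sub>E J F)) = (\<Prod>j\<in>J. emeasure \<mu> (F j))" .
  qed
qed

lemma emeasure_PiM_initial_cylinder:
  fixes \<mu> :: "'b measure"
  assumes \<mu>: "prob_space \<mu>" and B: "\<And>i. i < (m :: nat) \<Longrightarrow> B i \<in> sets \<mu>"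
  shows "emeasure (PiM UNIV (\<lambda>_. \<mu>)) {z \<in> space (PiM UNIV (\<lambda>_. \<mu>)). \<forall>i<m. z i \<in> B i} =
    (\<Prod>i<m. emeasure \<mu> (B i))"
proof -
  have "{z \<in> space (PiM UNIV (\<lambda>_. \<mu>)). \<forall>i<m. z i \<in> B i} =
    prod_emb UNIV (\<lambda>_. \<mu>) {..<m} (Pi\<^sub>E {..<m} B)"
    by (auto simp: prod_emb_def space_PiM PiE_iff)
  also have "emeasure (PiM UNIV (\<lambda>_. \<mu>)) \<dots> = (\<Prod>i<m. emeasure \<mu> (B i))"
    using assms by (intro emeasure_PiM_emb) auto
  finally show ?thesis .
qed

lemma measurable_PiM_concat:
  fixes \<mu> :: "'b measure"
  shows "(\<lambda>z j. z (j div n) (j mod n)) \<in>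
    measurable (PiM (UNIV :: nat set) (\<lambda>_. PiM (UNIV :: nat set) (\<lambda>_. \<mu>))) (PiM UNIV (\<lambda>_. \<mu>))"
proof (rule measurable_PiM_single')
  show "(\<lambda>z. z (j div n) (j mod n)) \<in>
    measurable (PiM (UNIV :: nat set) (\<lambda>_. PiM (UNIV :: nat set) (\<lambda>_. \<mu>))) \<mu>" for j
    by (rule measurable_compose[OF measurable_component_singleton[of "j div n"]]) simp_all
qed (auto simp: space_PiM PiE_iff)

text \<open>
  An initial cylinder of whole blocks of the concatenated sequence is a product of cylinders, one for
  each block. A block is a whole sequence of which a prefix is read, and not an \<open>n\<close>-tuple, so that
  the blocks and the result have the same law \<open>\<nu>\<close>.
\<close>

lemma distr_PiM_concat:
  fixes \<mu> :: "'b measure"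
  assumes \<mu>: "prob_space \<mu>" and n: "0 < n"
  defines "\<nu> \<equiv> PiM (UNIV :: nat set) (\<lambda>_. \<mu>)"
  shows "distr (PiM UNIV (\<lambda>_. \<nu>)) \<nu> (\<lambda>z j. z (j div n) (j mod n)) = \<nu>"
proof -
  have \<nu>: "prob_space \<nu>" unfolding \<nu>_def using \<mu> by (intro prob_space_PiM)
  let ?N = "PiM (UNIV :: nat set) (\<lambda>_. \<nu>)" let ?c = "\<lambda>z j. z (j div n) (j mod n)"
  have c: "?c \<in> measurable ?N \<nu>" unfolding \<nu>_def by (rule measurable_PiM_concat)
  have "distr ?N \<nu> ?c = PiM UNIV (\<lambda>_. \<mu>)"
  proof (rule PiM_eqI_initial_cylinders[OF \<mu> _ n])
    show "sets (distr ?N \<nu> ?c) = sets (PiM UNIV (\<lambda>_. \<mu>))" by (simp add: \<nu>_def)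
    fix B and L :: nat assume B: "\<And>i :: nat. B i \<in> sets \<mu>"
    let ?C = "\<lambda>i. {y \<in> space \<nu>. \<forall>r<n. y r \<in> B (i * n + r)}"
    have C: "?C i \<in> sets \<nu>" for i
      using B unfolding \<nu>_def by measurable
    have E: "{z \<in> space \<nu>. \<forall>i<L * n. z i \<in> B i} \<in> sets \<nu>"
      using B unfolding \<nu>_def by measurable
    have blocks: "(\<forall>j<L * n. z (j div n) (j mod n) \<in> B j) \<longleftrightarrow> (\<forall>i<L. \<forall>r<n. z i r \<in> B (i * n + r))" 
      for z :: "nat \<Rightarrow> nat \<Rightarrow> 'b"
    proof safe
      fix i r assume *: "\<forall>j<L * n. z (j div n) (j mod n) \<in> B j" "i < L" "r < n"
      have "i * n + r < Suc i * n" using *(3) by simp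
      also have "\<dots> \<le> L * n" using *(2) by (intro mult_right_mono) auto
      finally show "z i r \<in> B (i * n + r)" using *(1)[rule_format, of "i * n + r"] *(3) by simp
    next
      fix j assume *: "\<forall>i<L. \<forall>r<n. z i r \<in> B (i * n + r)" "j < L * n"
      then show "z (j div n) (j mod n) \<in> B j"
        using *(1)[rule_format, of "j div n" "j mod n"] n by (simp add: less_mult_imp_div_less)
    qed
    have "emeasure (distr ?N \<nu> ?c) {z \<in> space (distr ?N \<nu> ?c). \<forall>i<L * n. z i \<in> B i} =
      emeasure ?N {z \<in> space ?N. \<forall>i<L. z i \<in> ?C i}"
      unfolding space_distr emeasure_distr[OF c E]
      using measurable_space[OF c] blocks
      by (intro arg_cong[where f="emeasure ?N"]) (auto simp: space_PiM PiE_iff)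
    also have "\<dots> = (\<Prod>i<L. emeasure \<nu> (?C i))"
      by (intro emeasure_PiM_initial_cylinder \<nu> C)
    also have "\<dots> = (\<Prod>i<L. \<Prod>r<n. emeasure \<mu> (B (i * n + r)))"
      unfolding \<nu>_def using B by (simp add: emeasure_PiM_initial_cylinder[OF \<mu>])
    also have "\<dots> = (\<Prod>i<L. \<Prod>j\<in>{i * n..<i * n + n}. emeasure \<mu> (B j))"
    proof (rule prod.cong[OF refl])
      fix i
      show "(\<Prod>r<n. emeasure \<mu> (B (i * n + r))) = (\<Prod>j\<in>{i * n..<i * n + n}. emeasure \<mu> (B j))"
        using prod.shift_bounds_nat_ivl[of "\<lambda>j. emeasure \<mu> (B j)" 0 "i * n" n]
        by (simp add: add.commute atLeast0LessThan)
    qed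
    also have "\<dots> = (\<Prod>j<L * n. emeasure \<mu> (B j))" by (rule prod.nat_group)
    finally show "emeasure (distr ?N \<nu> ?c) {z \<in> space (distr ?N \<nu> ?c). \<forall>i<L * n. z i \<in> B i} =
      (\<Prod>i<L * n. emeasure \<mu> (B i))" .
  qed
  then show ?thesis by (simp add: \<nu>_def)
qed

section \<open>Sequences driven by a random state\<close>

text \<open>
  \<open>run f s e i\<close> is the state before the input \<open>e i\<close> is read, so it depends on
  \<open>e 0, \<dots>, e (i - 1)\<close> only: a choice made from it in round \<open>i\<close> is independent of \<open>e i\<close>.
\<close>

primrec run :: "('s \<Rightarrow> 'e \<Rightarrow> 's) \<Rightarrow> 's \<Rightarrow> (nat \<Rightarrow> 'e) \<Rightarrow> nat \<Rightarrow> 's" where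
  "run f s e 0 = s"
| "run f s e (Suc i) = f (run f s e i) (e i)"

lemma run_case_nat: "run f s (case_nat a e) (Suc i) = run f (f s a) e i"
  by (induction i) simp_all

lemma measurable_run:
  fixes s :: "'s::countable"
  assumes f: "\<And>s. f s \<in> measurable Q (count_space UNIV)"
  shows "(\<lambda>e. run f s e i) \<in> measurable (PiM UNIV (\<lambda>_. Q)) (count_space UNIV)"
proof (induction i)
  case (Suc i)
  have "(\<lambda>e. f s' (e i)) \<in> measurable (PiM UNIV (\<lambda>_. Q)) (count_space UNIV)" for s'
    by (rule measurable_compose[OF _ f]) simp
  then show ?case unfolding run.simps by (rule measurable_compose_countable[OF _ Suc])
qed simp

lemma measurable_run_output:
  fixes s :: "'s::countable"
  assumes f: "\<And>s. f s \<in> measurable Q (count_space UNIV)" and g: "\<And>s. g s \<in> measurable Q \<nu>"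
  shows "(\<lambda>e i. g (run f s e i) (e i)) \<in> measurable (PiM UNIV (\<lambda>_. Q)) (PiM UNIV (\<lambda>_. \<nu>))"
proof -
  have g': "(\<lambda>e. g s' (e i)) \<in> measurable (PiM UNIV (\<lambda>_. Q)) \<nu>" for s' i
    by (rule measurable_compose[OF _ g]) simp
  have "(\<lambda>e. g (run f s e i) (e i)) \<in> measurable (PiM UNIV (\<lambda>_. Q)) \<nu>" for i
    by (rule measurable_compose_countable[OF g' measurable_run[OF f]])
  then show ?thesis by (intro measurable_PiM_single') (auto dest: measurable_space simp: PiE_iff)
qed

text \<open>
  Fubini for the splitting of an i.i.d. sequence into its first entry and the rest, which is a
  sequence of the same law. Together with \<open>run_case_nat\<close> it is the Markov property at time one.
\<close>

lemma emeasure_PiM_first_step: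
  assumes Q: "prob_space Q" and E: "E \<in> sets (PiM (UNIV :: nat set) (\<lambda>_. Q))"
  shows "emeasure (PiM UNIV (\<lambda>_. Q)) E =
    (\<integral>\<^sup>+a. emeasure (PiM UNIV (\<lambda>_. Q)) {e \<in> space (PiM UNIV (\<lambda>_. Q)). case_nat a e \<in> E} \<partial>Q)"
proof -
  interpret sequence_space Q using Q by (rule sequence_space_prob)
  have c: "(\<lambda>(a, e). case_nat a e) \<in> measurable (Q \<Otimes>\<^sub>M S) S" by measurable
  have "emeasure S E = emeasure (Q \<Otimes>\<^sub>M S) ((\<lambda>(a, e). case_nat a e) -` E \<inter> space (Q \<Otimes>\<^sub>M S))"
    by (subst PiM_iter[symmetric], rule emeasure_distr[OF c E])
  also have "\<dots> = (\<integral>\<^sup>+a. emeasure S (Pair a -` ((\<lambda>(a, e). case_nat a e) -` E \<inter> space (Q \<Otimes>\<^sub>M S))) \<partial>Q)"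
    by (rule emeasure_pair_measure_alt) (rule measurable_sets[OF c E])
  also have "\<dots> = (\<integral>\<^sup>+a. emeasure S {e \<in> space S. case_nat a e \<in> E} \<partial>Q)"
    by (intro nn_integral_cong arg_cong[where f="emeasure S"]) (auto simp: space_pair_measure)
  finally show ?thesis .
qed

text \<open>
  If the output law is \<open>\<nu>\<close> in every state, then no information about the past passes through the
  state to the next output, so the outputs are i.i.d. although the states are dependent.
\<close>

lemma distr_run_output:
  fixes s :: "'s::countable"
  assumes Q: "prob_space Q" and \<nu>: "prob_space \<nu>"
    and f: "\<And>s. f s \<in> measurable Q (count_space UNIV)"
    and g: "\<And>s. g s \<in> measurable Q \<nu>" and law: "\<And>s. distr Q \<nu> (g s) = \<nu>"
  shows "distr (PiM UNIV (\<lambda>_. Q)) (PiM UNIV (\<lambda>_. \<nu>)) (\<lambda>e i. g (run f s e i) (e i)) = PiM UNIV (\<lambda>_. \<nu>)"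
proof (rule PiM_eqI_initial_cylinders[OF \<nu>, where b=1])
  let ?N = "PiM (UNIV :: nat set) (\<lambda>_. Q)" and ?V = "PiM (UNIV :: nat set) (\<lambda>_. \<nu>)"
  interpret N: prob_space ?N using Q by (intro prob_space_PiM)
  let ?Z = "\<lambda>s e i. g (run f s e i) (e i)"
  let ?E = "\<lambda>s L B. {e \<in> space ?N. \<forall>i<L. ?Z s e i \<in> B i}"
  have Z: "?Z s \<in> measurable ?N ?V" for s by (rule measurable_run_output[OF f g])
  have V: "{z \<in> space ?V. \<forall>i<L. z i \<in> B i} \<in> sets ?V" if "\<And>i. B i \<in> sets \<nu>" for B and L :: nat
    using that by measurable
  have E_eq: "?E s L B = ?Z s -` {z \<in> space ?V. \<forall>i<L. z i \<in> B i} \<inter> space ?N" for s L B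
    using measurable_space[OF Z[of s]] by auto
  have E: "?E s L B \<in> sets ?N" if "\<And>i. B i \<in> sets \<nu>" for s L B
    unfolding E_eq by (rule measurable_sets[OF Z V[OF that]])
  \<comment> \<open>The first input is split off, and not the last one: then the remaining run is again of the same
    kind, merely started in another state.\<close>
  have "emeasure ?N (?E s L B) = (\<Prod>i<L. emeasure \<nu> (B i))" if "\<And>i. B i \<in> sets \<nu>" for s L B
    using that
  proof (induction L arbitrary: s B)
    case 0 show ?case by (simp add: N.emeasure_space_1)
  next
    case (Suc L)
    have B[measurable]: "B i \<in> sets \<nu>" for i by (rule Suc.prems)
    have head: "{a \<in> space Q. g s a \<in> B 0} \<in> sets Q" using g[of s] by measurable
    have "emeasure ?N (?E s (Suc L) B) =
      (\<integral>\<^sup>+a. emeasure ?N {e \<in> space ?N. case_nat a e \<in> ?E s (Suc L) B} \<partial>Q)"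
      by (rule emeasure_PiM_first_step[OF Q E[OF B]])
    also have "\<dots> = (\<integral>\<^sup>+a. indicator {a \<in> space Q. g s a \<in> B 0} a *
        (\<Prod>i<L. emeasure \<nu> (B (Suc i))) \<partial>Q)"
    proof (rule nn_integral_cong)
      fix a assume a: "a \<in> space Q"
      have sp: "case_nat a e \<in> space ?N" if "e \<in> space ?N" for e
        using that a by (auto simp: space_PiM PiE_iff split: nat.split)
      have "{e \<in> space ?N. case_nat a e \<in> ?E s (Suc L) B} =
        (if g s a \<in> B 0 then ?E (f s a) L (\<lambda>i. B (Suc i)) else {})"
        using sp by (auto simp: less_Suc_eq_0_disj run_case_nat simp del: run.simps(2))
      then show "emeasure ?N {e \<in> space ?N. case_nat a e \<in> ?E s (Suc L) B} =
        indicator {a \<in> space Q. g s a \<in> B 0} a * (\<Prod>i<L. emeasure \<nu> (B (Suc i)))"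
        using Suc.IH[of "\<lambda>i. B (Suc i)" "f s a"] a by auto
    qed
    also have "\<dots> = emeasure Q {a \<in> space Q. g s a \<in> B 0} * (\<Prod>i<L. emeasure \<nu> (B (Suc i)))"
      using head by (simp add: nn_integral_multc)
    also have "emeasure Q {a \<in> space Q. g s a \<in> B 0} = emeasure \<nu> (B 0)"
      by (subst law[of s, symmetric])
        (auto simp: emeasure_distr[OF g] intro!: arg_cong[where f="emeasure Q"])
    finally show ?case by (simp add: prod.lessThan_Suc_shift del: prod.lessThan_Suc)
  qed
  then show "emeasure (distr ?N ?V (?Z s)) {z \<in> space (distr ?N ?V (?Z s)). \<forall>i<L * 1. z i \<in> B i} =
      (\<Prod>i<L * 1. emeasure \<nu> (B i))" if "\<And>i. B i \<in> sets \<nu>" for B L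
    using that V[of B L] by (simp add: emeasure_distr[OF Z] E_eq)
qed simp_all

section \<open>Turning over a fair coin\<close>

abbreviation fair_coin :: "bool measure" where
  "fair_coin \<equiv> measure_pmf (bernoulli_pmf (1/2))"

lemma nn_integral_fair_coin:
  assumes u: "u \<in> borel_measurable (M \<Otimes>\<^sub>M fair_coin)"
  shows "(\<integral>\<^sup>+z. u z \<partial>(M \<Otimes>\<^sub>M fair_coin)) = (\<integral>\<^sup>+\<omega>. (u (\<omega>, True) + u (\<omega>, False)) / 2 \<partial>M)"
proof -
  have "(\<integral>\<^sup>+z. u z \<partial>(M \<Otimes>\<^sub>M fair_coin)) = (\<integral>\<^sup>+\<omega>. \<integral>\<^sup>+c. u (\<omega>, c) \<partial>fair_coin \<partial>M)"
    using u by (rule measure_pmf.nn_integral_fst[symmetric])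
  also have "\<dots> = (\<integral>\<^sup>+\<omega>. (u (\<omega>, True) + u (\<omega>, False)) / 2 \<partial>M)"
    by (intro nn_integral_cong) (simp add: divide_ennreal_def distrib_right)
  finally show ?thesis .
qed

text \<open>
  The inputs of the next two functions are a sample point with the result of a coin toss. The state
  \<open>k\<close> will be the lead of the second random walk over the first one, in multiples of \<open>x\<close>. On \<open>A\<close> and
  as long as the lead is positive, heads gives \<open>(X, X')\<close> to the two walks and so lowers the lead by
  one, tails gives them \<open>(X', X)\<close> and so raises it by one.
\<close>

definition walk_step :: "'w set \<Rightarrow> nat \<Rightarrow> 'w \<times> bool \<Rightarrow> nat" where
  "walk_step A k z = (if k = 0 \<or> fst z \<notin> A then k else if snd z then k - 1 else k + 1)"

definition turned_coin :: "'w set \<Rightarrow> nat \<Rightarrow> 'w \<times> bool \<Rightarrow> bool" where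
  "turned_coin A k z = (if k = 0 \<or> fst z \<notin> A then snd z else \<not> snd z)"

lemma pred_fair_coin: "Measurable.pred (M \<Otimes>\<^sub>M fair_coin) snd"
  by (rule measurable_compose[OF measurable_snd]) simp

lemma pred_fst_in: "A \<in> sets M \<Longrightarrow> Measurable.pred (M \<Otimes>\<^sub>M N) (\<lambda>z. fst z \<in> A)"
  by (rule pred_sets2) auto

lemma measurable_walk_step:
  assumes "A \<in> sets M"
  shows "walk_step A k \<in> measurable (M \<Otimes>\<^sub>M fair_coin) (count_space UNIV)"
proof -
  note [measurable] = pred_fair_coin pred_fst_in[OF assms]
  show ?thesis unfolding walk_step_def[abs_def] by measurable
qed

lemma measurable_turned_coin:
  assumes "A \<in> sets M"
  shows "Measurable.pred (M \<Otimes>\<^sub>M fair_coin) (turned_coin A k)"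
proof -
  note [measurable] = pred_fair_coin pred_fst_in[OF assms]
  show ?thesis unfolding turned_coin_def[abs_def] by measurable
qed

lemma measurable_choose:
  assumes A: "A \<in> sets M" and X: "X \<in> measurable M \<nu>" "X' \<in> measurable M \<nu>"
  shows "(\<lambda>z. if turned_coin A k z then X (fst z) else X' (fst z)) \<in> measurable (M \<Otimes>\<^sub>M fair_coin) \<nu>"
  using measurable_turned_coin[OF A, of k]
  by (intro measurable_If measurable_compose[OF measurable_fst X(1)]
      measurable_compose[OF measurable_fst X(2)]) (simp add: pred_def)

text \<open>
  For each sample point, turning the coin over or not only decides which of the values of \<open>X\<close> and
  \<open>X'\<close> belongs to heads; a fair coin gives both the same weight. So the law is the mean of the laws
  of \<open>X\<close> and \<open>X'\<close>, whatever \<open>A\<close> and \<open>k\<close> are.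
\<close>

lemma distr_turned_coin:
  assumes A: "A \<in> sets M"
    and X: "X \<in> measurable M \<nu>" "X' \<in> measurable M \<nu>"
    and law: "distr M \<nu> X = \<nu>" "distr M \<nu> X' = \<nu>" and \<nu>: "prob_space \<nu>"
  shows "distr (M \<Otimes>\<^sub>M fair_coin) \<nu> (\<lambda>z. if turned_coin A k z then X (fst z) else X' (fst z)) = \<nu>"
    (is "distr ?Q \<nu> ?Y = \<nu>")
proof (rule measure_eqI)
  interpret P: prob_space \<nu> by fact
  fix B assume "B \<in> sets (distr ?Q \<nu> ?Y)"
  then have B [measurable]: "B \<in> sets \<nu>" by simp
  have meas: "(\<lambda>\<omega>. indicator B (V \<omega>) :: ennreal) \<in> borel_measurable M" if "V \<in> measurable M \<nu>" for V
    using that by (rule measurable_compose) simp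
  have eq: "(\<integral>\<^sup>+\<omega>. indicator B (V \<omega>) \<partial>M) = emeasure \<nu> B"
    if V: "V \<in> measurable M \<nu>" "distr M \<nu> V = \<nu>" for V
  proof -
    have "emeasure \<nu> B = (\<integral>\<^sup>+y. indicator B y \<partial>distr M \<nu> V)" by (simp add: V(2))
    also have "\<dots> = (\<integral>\<^sup>+\<omega>. indicator B (V \<omega>) \<partial>M)" by (rule nn_integral_distr[OF V(1)]) simp
    finally show ?thesis by simp
  qed
  have Y: "?Y \<in> measurable ?Q \<nu>" by (rule measurable_choose[OF A X])
  have "emeasure (distr ?Q \<nu> ?Y) B = (\<integral>\<^sup>+y. indicator B y \<partial>distr ?Q \<nu> ?Y)" by simp
  also have "\<dots> = (\<integral>\<^sup>+z. indicator B (?Y z) \<partial>?Q)" by (rule nn_integral_distr[OF Y]) simp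
  also have "\<dots> = (\<integral>\<^sup>+\<omega>. (indicator B (?Y (\<omega>, True)) + indicator B (?Y (\<omega>, False))) / 2 \<partial>M)"
    by (rule nn_integral_fair_coin) (rule measurable_compose[OF Y], simp)
  also have "\<dots> = (\<integral>\<^sup>+\<omega>. (indicator B (X \<omega>) + indicator B (X' \<omega>)) / 2 \<partial>M)"
    by (intro nn_integral_cong) (auto simp: turned_coin_def add.commute)
  also have "\<dots> = (emeasure \<nu> B + emeasure \<nu> B) / 2"
    using eq[OF X(1) law(1)] eq[OF X(2) law(2)] meas[OF X(1)] meas[OF X(2)]
    by (simp add: nn_integral_divide nn_integral_add)
  also have "\<dots> = ennreal ((P.prob B + P.prob B) / 2)"
    unfolding P.emeasure_eq_measure by (subst ennreal_plus[symmetric]) (simp_all add: ennreal_divide_numeral del: ennreal_plus)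
  finally show "emeasure (distr ?Q \<nu> ?Y) B = emeasure \<nu> B"
    by (simp add: P.emeasure_eq_measure)
qed simp

section \<open>The lazy symmetric walk reaches zero\<close>

text \<open>
  Harmonicity makes the differences of neighbouring values constant, so \<open>h\<close> is linear; a bounded
  linear function is constant.
\<close>

lemma bounded_harmonic_zero:
  fixes h :: "nat \<Rightarrow> real"
  assumes h0: "h 0 = 0" and mean: "\<And>k. 2 * h (Suc k) = h k + h (Suc (Suc k))"
    and bound: "\<And>k. \<bar>h k\<bar> \<le> 1"
  shows "h k = 0"
proof -
  have diff: "h (Suc k) - h k = h 1" for k
  proof (induction k)
    case (Suc k) then show ?case using mean[of k] by simp
  qed (simp add: h0)
  have linear: "h k = real k * h 1" for k
  proof (induction k)
    case (Suc k) then show ?case using diff[of k] by (simp add: algebra_simps)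
  qed (simp add: h0)
  have "h 1 = 0"
  proof (rule ccontr)
    assume "h 1 \<noteq> 0"
    then obtain m :: nat where "1 < real m * \<bar>h 1\<bar>" using reals_Archimedean3[of "\<bar>h 1\<bar>"] by auto
    then show False using bound[of m] linear[of m] by (simp add: abs_mult)
  qed
  then show ?thesis using linear[of k] by simp
qed

text \<open>
  Conditioning on the first round shows that the probability \<open>h k\<close> of avoiding \<open>0\<close> from \<open>k\<close>
  is a mixture, with weights \<open>p\<close> and \<open>1 - p\<close>, of the mean of its neighbouring values and of itself.
  As \<open>p > 0\<close>, the laziness cancels and \<open>h\<close> is harmonic.
\<close>

lemma walk_hits_zero:
  assumes M: "prob_space M" and A: "A \<in> sets M" and pos: "0 < emeasure M A"
  shows "AE e in PiM UNIV (\<lambda>_. M \<Otimes>\<^sub>M fair_coin). \<exists>i. run (walk_step A) k e i = 0"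
proof -
  interpret M: prob_space M by fact
  let ?Q = "M \<Otimes>\<^sub>M fair_coin" let ?N = "PiM (UNIV :: nat set) (\<lambda>_. ?Q)"
  have Q: "prob_space ?Q" using M by (rule prob_space_pair) (rule measure_pmf.prob_space_axioms)
  interpret N: prob_space ?N using Q by (intro prob_space_PiM)
  define E where "E k = {e \<in> space ?N. \<forall>i. run (walk_step A) k e i \<noteq> 0}" for k
  define h where "h k = measure ?N (E k)" for k
  have [measurable]: "(\<lambda>e. run (walk_step A) k e i) \<in> measurable ?N (count_space UNIV)" for k i
    by (rule measurable_run) (rule measurable_walk_step[OF A])
  have E [measurable]: "E k \<in> sets ?N" for k unfolding E_def by measurable
  have eE: "emeasure ?N (E k) = ennreal (h k)" for k by (simp add: h_def N.emeasure_eq_measure)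
  have h_nonneg: "0 \<le> h k" for k by (simp add: h_def)
  define p where "p = measure M A"
  have p: "0 < p" "p \<le> 1" using pos by (simp_all add: p_def M.emeasure_eq_measure)
  have mean: "2 * h (Suc k) = h k + h (Suc (Suc k))" for k
  proof -
    have meas: "(\<lambda>a. ennreal (h (walk_step A (Suc k) a))) \<in> borel_measurable ?Q"
      by (rule measurable_compose[OF measurable_walk_step[OF A]]) simp
    have "ennreal (h (Suc k)) = (\<integral>\<^sup>+a. ennreal (h (walk_step A (Suc k) a)) \<partial>?Q)"
      unfolding eE[symmetric]
    proof (subst emeasure_PiM_first_step[OF Q E], intro nn_integral_cong arg_cong[where f="emeasure ?N"])
      fix a assume a: "a \<in> space ?Q"
      have sp: "case_nat a e \<in> space ?N" if "e \<in> space ?N" for e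
        using that a by (auto simp: space_PiM PiE_iff split: nat.split)
      have all: "(\<forall>i. P i) \<longleftrightarrow> P 0 \<and> (\<forall>i. P (Suc i))" for P :: "nat \<Rightarrow> bool"
        by (metis not0_implies_Suc)
      show "{e \<in> space ?N. case_nat a e \<in> E (Suc k)} = E (walk_step A (Suc k) a)"
        unfolding E_def by (subst all) (auto simp: sp run_case_nat simp del: run.simps(2))
    qed
    also have "\<dots> = (\<integral>\<^sup>+\<omega>. ennreal ((h k + h (Suc (Suc k))) / 2) * indicator A \<omega> +
        ennreal (h (Suc k)) * indicator (space M - A) \<omega> \<partial>M)"
      unfolding nn_integral_fair_coin[OF meas]
      by (intro nn_integral_cong)
        (auto simp: walk_step_def indicator_def h_nonneg ennreal_divide_numeral simp flip: ennreal_plus)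
    also have "\<dots> = ennreal ((h k + h (Suc (Suc k))) / 2) * emeasure M A +
        ennreal (h (Suc k)) * emeasure M (space M - A)"
      using A by (subst nn_integral_add) (auto simp: nn_integral_cmult_indicator)
    also have "\<dots> = ennreal ((h k + h (Suc (Suc k))) / 2) * ennreal p + ennreal (h (Suc k)) * ennreal (1 - p)"
      unfolding p_def M.prob_compl[OF A, symmetric] M.emeasure_eq_measure by (rule refl)
    also have "\<dots> = ennreal ((h k + h (Suc (Suc k))) / 2 * p + h (Suc k) * (1 - p))"
      using p h_nonneg by (simp del: ennreal_half flip: ennreal_mult ennreal_plus)
    finally have "h (Suc k) = (h k + h (Suc (Suc k))) / 2 * p + h (Suc k) * (1 - p)"
      using p h_nonneg by (subst (asm) ennreal_inj) simp_all
    then have "p * (2 * h (Suc k) - (h k + h (Suc (Suc k)))) = 0"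
      by (simp add: algebra_simps)
    then show ?thesis using p by simp
  qed
  have "h k = 0"
  proof (rule bounded_harmonic_zero[where h=h, OF _ mean])
    have "E 0 = {}" unfolding E_def by (auto intro!: exI[of _ 0])
    then show "h 0 = 0" by (simp add: h_def)
  qed (simp add: h_def)
  then have "emeasure ?N (E k) = 0" by (simp add: eE)
  then show ?thesis by (intro AE_I'[of "E k"]) (auto simp: E_def null_sets_def)
qed

section \<open>The coupling\<close>

lemma sum_lessThan_add:
  fixes u :: "nat \<Rightarrow> 'b::comm_monoid_add"
  shows "(\<Sum>j<a + n. u j) = (\<Sum>j<a. u j) + (\<Sum>r<n. u (a + r))"
  by (induction n) (simp_all add: add.assoc)

lemma borel_measurable_group_diff [measurable]:
  fixes u v :: "'b \<Rightarrow> 'a::{second_countable_topology, topological_ab_group_add}"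
  assumes "u \<in> borel_measurable M" "v \<in> borel_measurable M"
  shows "(\<lambda>\<omega>. u \<omega> - v \<omega>) \<in> borel_measurable M"
  using assms by (rule borel_measurable_continuous_Pair) (intro continuous_intros)

lemma measurable_partial_sums:
  fixes \<mu> :: "'a::{polish_space, topological_ab_group_add} measure"
  assumes "sets \<mu> = sets borel"
  shows "(\<lambda>u n. x + (\<Sum>i<n. u i)) \<in> measurable (PiM UNIV (\<lambda>_::nat. \<mu>)) path_space"
proof (rule measurable_PiM_single')
  have [measurable]: "(\<lambda>u. u i) \<in> borel_measurable (PiM UNIV (\<lambda>_::nat. \<mu>))" for i
    using measurable_component_singleton[of i UNIV "\<lambda>_. \<mu>"] assms by (simp cong: measurable_cong_sets)
  show "(\<lambda>u. x + (\<Sum>i<n. u i)) \<in> borel_measurable (PiM UNIV (\<lambda>_::nat. \<mu>))" for n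
    by measurable
qed simp

text \<open>
  The heart of the matter: one joint law of two i.i.d. sequences, for which the sums of the first
  \<open>n\<close> terms differ by exactly \<open>x\<close> with positive probability, suffices for a successful coupling.
\<close>

lemma successful_coupling_of_collision:
  fixes \<mu> :: "'a::{polish_space, topological_ab_group_add} measure" and M :: "'w measure"
  assumes \<mu>: "prob_space \<mu>" and sets_\<mu>: "sets \<mu> = sets borel" and M: "prob_space M"
    and X: "X \<in> measurable M (PiM UNIV (\<lambda>_. \<mu>))" "distr M (PiM UNIV (\<lambda>_. \<mu>)) X = PiM UNIV (\<lambda>_. \<mu>)"
    and X': "X' \<in> measurable M (PiM UNIV (\<lambda>_. \<mu>))" "distr M (PiM UNIV (\<lambda>_. \<mu>)) X' = PiM UNIV (\<lambda>_. \<mu>)"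
    and n: "0 < (n :: nat)" and A: "A \<in> sets M" "0 < emeasure M A"
    and collision: "\<And>\<omega>. \<omega> \<in> A \<Longrightarrow> (\<Sum>r<n. X \<omega> r) = x + (\<Sum>r<n. X' \<omega> r)"
  shows "x \<in> successful_coupling_set \<mu>"
proof -
  let ?\<nu> = "PiM (UNIV :: nat set) (\<lambda>_. \<mu>)"
  let ?Q = "M \<Otimes>\<^sub>M fair_coin" let ?N = "PiM (UNIV :: nat set) (\<lambda>_. ?Q)"
  have \<nu>: "prob_space ?\<nu>" using \<mu> by (intro prob_space_PiM)
  have Q: "prob_space ?Q" using M by (rule prob_space_pair) (rule measure_pmf.prob_space_axioms)
  have N: "prob_space ?N" using Q by (intro prob_space_PiM)

  \<comment> \<open>\<open>Y\<close> and \<open>Z\<close> are the increments of the two walks, \<open>K\<close> the lead after \<open>i\<close> blocks. The state \<open>0\<close> in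
    \<open>Y\<close> means that the first walk always obeys the original coin.\<close>
  define G where "G k z = (if turned_coin A k z then X (fst z) else X' (fst z))" for k z
  define K where "K e i = run (walk_step A) 1 e i" for e i
  define Y where "Y e j = G 0 (e (j div n)) (j mod n)" for e j
  define Z where "Z e j = G (K e (j div n)) (e (j div n)) (j mod n)" for e j

  have G: "G k \<in> measurable ?Q ?\<nu>" for k
    unfolding G_def[abs_def] using A(1) X(1) X'(1) by (rule measurable_choose)
  have G_law: "distr ?Q ?\<nu> (G k) = ?\<nu>" for k
    unfolding G_def[abs_def] using A(1) X(1) X'(1) X(2) X'(2) \<nu> by (rule distr_turned_coin)
  have increments: "(\<lambda>e j. G (run f s e (j div n)) (e (j div n)) (j mod n)) \<in> measurable ?N ?\<nu>"
    "distr ?N ?\<nu> (\<lambda>e j. G (run f s e (j div n)) (e (j div n)) (j mod n)) = ?\<nu>"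
    if f: "\<And>s. f s \<in> measurable ?Q (count_space UNIV)" for f :: "nat \<Rightarrow> 'w \<times> bool \<Rightarrow> nat" and s
  proof -
    note W = measurable_run_output[where f=f and s=s and g=G, OF f G]
    show "(\<lambda>e j. G (run f s e (j div n)) (e (j div n)) (j mod n)) \<in> measurable ?N ?\<nu>"
      by (rule measurable_compose[OF W measurable_PiM_concat])
    show "distr ?N ?\<nu> (\<lambda>e j. G (run f s e (j div n)) (e (j div n)) (j mod n)) = ?\<nu>"
      using distr_distr[OF measurable_PiM_concat W] distr_run_output[where f=f and s=s and g=G, OF Q \<nu> f G G_law]
        distr_PiM_concat[OF \<mu> n] by (simp add: comp_def)
  qed
  have K_step: "walk_step A k \<in> measurable ?Q (count_space UNIV)" for k
    by (rule measurable_walk_step[OF A(1)])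
  have run0: "run (\<lambda>s _. s) s e i = s" for s :: nat and e :: "nat \<Rightarrow> 'w \<times> bool" and i
    by (induction i) simp_all
  \<comment> \<open>Both laws come from the same statement: for \<open>Y\<close> the state is constantly \<open>0\<close>.\<close>
  have Y: "Y \<in> measurable ?N ?\<nu>" "distr ?N ?\<nu> Y = ?\<nu>"
    using increments[of "\<lambda>s _. s" 0] by (simp_all add: Y_def[abs_def] run0)
  have Z: "Z \<in> measurable ?N ?\<nu>" "distr ?N ?\<nu> Z = ?\<nu>"
    using increments[of "walk_step A" 1, OF K_step] by (simp_all add: Z_def[abs_def] K_def)

  \<comment> \<open>The summand \<open>0\<close> is the starting point, kept so that both walks have the same form.\<close>
  define S where "S e m = 0 + (\<Sum>j<m. Y e j)" for e m
  define S' where "S' e m = x + (\<Sum>j<m. Z e j)" for e m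
  have walk: "(\<lambda>e m. y + (\<Sum>j<m. W e j)) \<in> measurable ?N path_space"
    "distr ?N path_space (\<lambda>e m. y + (\<Sum>j<m. W e j)) = RW y \<mu>"
    if W: "W \<in> measurable ?N ?\<nu>" "distr ?N ?\<nu> W = ?\<nu>" for W y
  proof -
    note sums = measurable_partial_sums[OF sets_\<mu>, of y]
    show "(\<lambda>e m. y + (\<Sum>j<m. W e j)) \<in> measurable ?N path_space"
      by (rule measurable_compose[OF W(1) sums])
    show "distr ?N path_space (\<lambda>e m. y + (\<Sum>j<m. W e j)) = RW y \<mu>"
      unfolding RW_def using distr_distr[OF sums W(1)] by (simp add: comp_def W(2))
  qed
  have S: "S \<in> measurable ?N path_space" "distr ?N path_space S = RW 0 \<mu>"
    unfolding S_def[abs_def] by (fact walk[OF Y])+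
  have S': "S' \<in> measurable ?N path_space" "distr ?N path_space S' = RW x \<mu>"
    unfolding S'_def[abs_def] by (fact walk[OF Z])+

  have gap: "S' e (i * n) = S e (i * n) + (\<Sum>_<K e i. x)" for e i
  proof (induction i)
    case 0 show ?case by (simp add: S_def S'_def K_def)
  next
    case (Suc i)
    let ?k = "K e i" and ?a = "e i"
    have blocks: "S e (Suc i * n) = S e (i * n) + (\<Sum>r<n. G 0 ?a r)"
      "S' e (Suc i * n) = S' e (i * n) + (\<Sum>r<n. G ?k ?a r)"
      using sum_lessThan_add[of "Y e" "i * n" n] sum_lessThan_add[of "Z e" "i * n" n] n
      by (simp_all add: S_def S'_def Y_def Z_def add.assoc add.commute[of n])
    show ?case
    proof (cases "?k = 0 \<or> fst ?a \<notin> A")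
      case True
      then have "G ?k ?a = G 0 ?a" "K e (Suc i) = ?k"
        by (auto simp: G_def turned_coin_def K_def walk_step_def)
      then show ?thesis using blocks Suc by (simp add: algebra_simps)
    next
      case False
      then obtain k where k: "?k = Suc k" and a: "fst ?a \<in> A" by (cases ?k) auto
      show ?thesis
      proof (cases "snd ?a")
        case True
        then have "G 0 ?a = X (fst ?a)" "G ?k ?a = X' (fst ?a)" "K e (Suc i) = k"
          using k a by (auto simp: G_def turned_coin_def K_def walk_step_def)
        then show ?thesis using blocks Suc k collision[OF a] by (simp add: algebra_simps)
      next
        case False
        then have "G 0 ?a = X' (fst ?a)" "G ?k ?a = X (fst ?a)" "K e (Suc i) = Suc (Suc k)"
          using k a by (auto simp: G_def turned_coin_def K_def walk_step_def)
        then show ?thesis using blocks Suc k collision[OF a] by (simp add: algebra_simps)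
      qed
    qed
  qed
  \<comment> \<open>In state \<open>0\<close> the coin is not turned over, so from the first visit of \<open>0\<close> on the increments agree.\<close>
  have absorbed: "K e (i + d) = 0" if "K e i = 0" for e i d
    using that by (induction d) (simp_all add: K_def walk_step_def)
  have glued: "S e m = S' e m" if i: "K e i = 0" and m: "i * n \<le> m" for e i m
  proof -
    obtain d where d: "m = i * n + d" using m le_Suc_ex by blast
    have "Z e (i * n + r) = Y e (i * n + r)" for r
      using absorbed[OF i, of "r div n"] n by (simp add: Z_def Y_def)
    then show ?thesis
      using gap[of e i] i unfolding d S_def S'_def sum_lessThan_add by simp
  qed

  define T where "T e = (if \<exists>i. K e i = 0 then enat ((LEAST i. K e i = 0) * n) else \<infinity>)" for e
  have [measurable]: "(\<lambda>e. K e i) \<in> measurable ?N (count_space UNIV)" for i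
    unfolding K_def by (rule measurable_run[OF K_step])
  have [measurable]: "T \<in> measurable ?N (count_space UNIV)"
    unfolding T_def[abs_def] by measurable
  have "exact_coupling \<mu> x ?N S S' T"
    unfolding exact_coupling_def
  proof (intro conjI N S S' ballI allI impI)
    fix e m assume "T e \<le> enat m"
    then obtain i where i: "K e i = 0" and m: "(LEAST i. K e i = 0) * n \<le> m"
      by (auto simp: T_def split: if_splits)
    show "S e m = S' e m" by (rule glued[OF LeastI[of "\<lambda>i. K e i = 0", OF i] m])
  qed measurable
  moreover have "AE e in ?N. T e < \<infinity>"
    using walk_hits_zero[OF M A, of 1] by eventually_elim (simp add: T_def K_def)
  ultimately show ?thesis by (rule successful_coupling_setI)
qed

text \<open>
  The increments are recovered from the path by a measurable map, so their law is determined by the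
  law of the path. The path is recovered from them and \<open>x\<close> only almost surely: a process with the
  law of the walk may start elsewhere on a null set.
\<close>

lemma increments_of_random_walk:
  fixes \<mu> :: "'a::{polish_space, topological_ab_group_add} measure"
  assumes sets_\<mu>: "sets \<mu> = sets borel"
    and S: "S \<in> measurable M path_space" and law: "distr M path_space S = RW x \<mu>"
  defines "X \<equiv> \<lambda>\<omega> i. S \<omega> (Suc i) - S \<omega> i"
  shows "X \<in> measurable M (PiM UNIV (\<lambda>_. \<mu>))"
    and "distr M (PiM UNIV (\<lambda>_. \<mu>)) X = PiM UNIV (\<lambda>_. \<mu>)"
    and "AE \<omega> in M. S \<omega> n = x + (\<Sum>i<n. X \<omega> i)"
proof -
  let ?\<nu> = "PiM (UNIV :: nat set) (\<lambda>_. \<mu>)"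
  let ?inc = "\<lambda>s i. s (Suc i) - s i :: 'a" let ?walk = "\<lambda>u n. x + (\<Sum>i<n. u i)"
  have sets_\<nu>: "sets ?\<nu> = sets path_space" by (rule sets_PiM_cong) (simp_all add: sets_\<mu>)
  have coord: "(\<lambda>s. s i) \<in> borel_measurable path_space" for i :: nat
    by (rule measurable_component_singleton) simp
  have "?inc \<in> measurable path_space path_space"
  proof (rule measurable_PiM_single')
    show "(\<lambda>s. s (Suc i) - s i :: 'a) \<in> borel_measurable path_space" for i
      by (intro borel_measurable_group_diff coord)
  qed simp
  then have inc: "?inc \<in> measurable path_space ?\<nu>"
    using sets_\<nu> by (simp cong: measurable_cong_sets)
  note walk = measurable_partial_sums[OF sets_\<mu>, of x]
  have X_eq: "X = ?inc \<circ> S" by (auto simp: X_def)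
  show "X \<in> measurable M ?\<nu>" unfolding X_eq using S inc by (rule measurable_comp)
  have "distr M ?\<nu> X = distr (distr M path_space S) ?\<nu> ?inc"
    unfolding X_eq by (rule distr_distr[OF inc S, symmetric])
  also have "\<dots> = distr ?\<nu> ?\<nu> (?inc \<circ> ?walk)"
    unfolding law RW_def by (rule distr_distr[OF inc walk])
  also have "?inc \<circ> ?walk = (\<lambda>u. u)" by (auto simp: fun_eq_iff)
  finally show "distr M ?\<nu> X = ?\<nu>" by simp
  have "AE s in distr M path_space S. s 0 = x"
    unfolding law RW_def using walk by (subst AE_distr_iff) auto
  then have "AE \<omega> in M. S \<omega> 0 = x" using S by (subst (asm) AE_distr_iff) auto
  then show "AE \<omega> in M. S \<omega> n = x + (\<Sum>i<n. X \<omega> i)"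
    by eventually_elim (simp add: X_def sum_lessThan_telescope)
qed

text \<open>
  The meeting time is finite with positive probability, hence at most \<open>n\<close> with positive probability
  for some \<open>n\<close>; by then the walks agree, which is a collision of their increments.
\<close>

lemma possible_imp_successful:
  fixes \<mu> :: "'a::{polish_space, topological_ab_group_add} measure" and M :: "'w measure"
  assumes \<mu>: "prob_space \<mu>" and sets_\<mu>: "sets \<mu> = sets borel"
    and coupling: "exact_coupling \<mu> x M S S' T" and pos: "\<P>(\<omega> in M. T \<omega> < \<infinity>) > 0"
  shows "x \<in> successful_coupling_set \<mu>"
proof -
  have M: "prob_space M"
    and S: "S \<in> measurable M path_space" "distr M path_space S = RW 0 \<mu>"
    and S': "S' \<in> measurable M path_space" "distr M path_space S' = RW x \<mu>"
    and T [measurable]: "T \<in> measurable M (count_space UNIV)"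
    and meet: "\<And>\<omega> n. \<omega> \<in> space M \<Longrightarrow> T \<omega> \<le> enat n \<Longrightarrow> S \<omega> n = S' \<omega> n"
    using coupling by (auto simp: exact_coupling_def)
  interpret prob_space M by fact
  obtain n where n: "emeasure M {\<omega> \<in> space M. T \<omega> \<le> enat n} \<noteq> 0"
  proof (rule ccontr)
    assume "\<not> thesis"
    then have "AE \<omega> in M. \<not> T \<omega> \<le> enat n" for n using that by (subst AE_iff_measurable) auto
    then have "AE \<omega> in M. \<forall>n. \<not> T \<omega> \<le> enat n" by (simp add: AE_all_countable)
    then have "AE \<omega> in M. \<not> T \<omega> < \<infinity>" by eventually_elim (metis less_infinityE order_refl)
    then have "\<P>(\<omega> in M. T \<omega> < \<infinity>) = 0" by (subst prob_eq_0) auto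
    with pos show False by simp
  qed
  \<comment> \<open>A block must not be empty, so the walks are compared at time \<open>Suc n\<close>, where they still agree. The
    event is phrased by increments, as the starting points are only almost surely \<open>0\<close> and \<open>x\<close>.\<close>
  let ?X = "\<lambda>\<omega> i. S \<omega> (Suc i) - S \<omega> i" and ?X' = "\<lambda>\<omega> i. S' \<omega> (Suc i) - S' \<omega> i"
  define A where "A = {\<omega> \<in> space M. (\<Sum>r<Suc n. ?X \<omega> r) = x + (\<Sum>r<Suc n. ?X' \<omega> r)}"
  have [measurable]: "(\<lambda>\<omega>. S \<omega> i) \<in> borel_measurable M" "(\<lambda>\<omega>. S' \<omega> i) \<in> borel_measurable M" for i
    using measurable_compose[OF S(1) measurable_component_singleton[of i UNIV "\<lambda>_. borel"]]
      measurable_compose[OF S'(1) measurable_component_singleton[of i UNIV "\<lambda>_. borel"]] by simp_all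
  have A: "A \<in> sets M" unfolding A_def by (rule measurable_equality_set) measurable
  have "AE \<omega> in M. \<omega> \<in> {\<omega> \<in> space M. T \<omega> \<le> enat n} \<longrightarrow> \<omega> \<in> A"
    using increments_of_random_walk(3)[OF sets_\<mu> S, of "Suc n"]
      increments_of_random_walk(3)[OF sets_\<mu> S', of "Suc n"]
  proof eventually_elim
    case (elim \<omega>)
    show ?case
    proof
      assume *: "\<omega> \<in> {\<omega> \<in> space M. T \<omega> \<le> enat n}"
      then have "T \<omega> \<le> enat (Suc n)" by (auto elim: order_trans)
      then have "S \<omega> (Suc n) = S' \<omega> (Suc n)" using * by (intro meet) auto
      then show "\<omega> \<in> A" using * elim by (simp add: A_def del: sum.lessThan_Suc)
    qed
  qed
  then have "emeasure M {\<omega> \<in> space M. T \<omega> \<le> enat n} \<le> emeasure M A"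
    using A by (intro emeasure_mono_AE)
  then have A_pos: "0 < emeasure M A" using n by (auto simp: zero_less_iff_neq_zero)
  show ?thesis
    by (rule successful_coupling_of_collision[OF \<mu> sets_\<mu> M
          increments_of_random_walk(1,2)[OF sets_\<mu> S] increments_of_random_walk(1,2)[OF sets_\<mu> S'] _ A A_pos])
      (auto simp: A_def)
qed

theorem corollary6p2:
  fixes \<mu> :: "'a::{polish_space, topological_ab_group_add} measure"
  assumes "prob_space \<mu>" and "sets \<mu> = sets borel"
  shows "possible_coupling_set \<mu> = successful_coupling_set \<mu>"
proof
  show "possible_coupling_set \<mu> \<subseteq> successful_coupling_set \<mu>"
    using possible_imp_successful[OF assms] by (auto simp: possible_coupling_set_def)
  show "successful_coupling_set \<mu> \<subseteq> possible_coupling_set \<mu>"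
  proof
    fix x assume "x \<in> successful_coupling_set \<mu>"
    then obtain M :: "'a sample measure" and S S' T
      where coupling: "exact_coupling \<mu> x M S S' T" and finite: "AE \<omega> in M. T \<omega> < \<infinity>"
      by (auto simp: successful_coupling_set_def)
    interpret prob_space M using coupling by (simp add: exact_coupling_def)
    have [measurable]: "T \<in> measurable M (count_space UNIV)" using coupling by (simp add: exact_coupling_def)
    have "\<P>(\<omega> in M. T \<omega> < \<infinity>) = 1" using finite by (subst prob_eq_1) auto
    then have "\<P>(\<omega> in M. T \<omega> < \<infinity>) > 0" by linarith
    with coupling show "x \<in> possible_coupling_set \<mu>" by (rule possible_coupling_setI)
  qed
qed

end
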